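(* Let $f=[f^L,f^U]\colon\mathbb{R}^n\to\mathcal{K}_c$ be an interval-valued function and let $X=\{x\in\mathbb{R}^n : g_j(x)\le 0,\ j=1,\dots,m\}$ with $g_j\colon\mathbb{R}^n\to\mathbb{R}$. Let $\mathcal{E}=[\epsilon^L,\epsilon^U]$ with $0\le\epsilon^L\le\epsilon^U$, let $\epsilon:=(\epsilon^U,\epsilon^L)\in\mathbb{R}^2_+$, and let $F(x):=(f^L(x),f^U(x))$ for $x\in\mathbb{R}^n$. For a point $x^*$ the following three equivalences hold: (a) $x^*$ is a weakly $\mathcal{E}$-$LU$-solution of the problem of minimizing $f$ over $X$ if and only if $x^*$ is a weakly $\epsilon$-efficient solution of $\mathrm{Min}_{\mathbb{R}^2_+}\{F(x): x\in X\}$; (b) $x^*$ is an $\mathcal{E}$-quasi-$LU$-solution of the problem of minimizing $f$ over $X$ if and only if $x^*$ is an $\epsilon$-quasi-efficient solution of $\mathrm{Min}_{\mathbb{R}^2_+}\{F(x): x\in X\}$; (c) $x^*$ is a weakly $\mathcal{E}$-quasi-$LU$-solution of the problem of minimizing $f$ over $X$ if and only if $x^*$ is a weakly $\epsilon$-quasi-efficient solution of $\mathrm{Min}_{\mathbb{R}^2_+}\{F(x): x\in X\}$.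
   Context: $\mathcal{K}_c$ is the set of all closed bounded intervals $[a^L,a^U]\subset\mathbb{R}$, $a^L\le a^U$. An interval-valued function is $f(x)=[f^L(x),f^U(x)]$ with $f^L,f^U\colon\mathbb{R}^n\to\mathbb{R}$ and $f^L(x)\le f^U(x)$ for all $x$. Interval arithmetic: $[a^L,a^U]-[b^L,b^U]=[a^L-b^U,\,a^U-b^L]$, and $k[a^L,a^U]=[ka^L,ka^U]$ for real $k\ge0$. $\|\cdot\|$ is the Euclidean norm. Order: $[a^L,a^U]\preceq_{LU}[b^L,b^U]$ iff $a^L\le b^L$ and $a^U\le b^U$; $A\prec_{LU}B$ iff $A\preceq_{LU}B$ and $A\ne B$; $[a^L,a^U]\prec^s_{LU}[b^L,b^U]$ iff $a^L<b^L$ and $a^U<b^U$. For $x^*\in X$: - $x^*$ is a weakly $\mathcal{E}$-$LU$-solution if there is no $x\in X$ with $f(x)\prec^s_{LU}f(x^* )-\mathcal{E}$; - $x^*$ is an $\mathcal{E}$-quasi-$LU$-solution if there is no $x\in X$ with $f(x)\prec_{LU}f(x^* )-\mathcal{E}\|x-x^*\|$; - $x^*$ is a weakly $\mathcal{E}$-quasi-$LU$-solution if there is no $x\in X$ with $f(x)\prec^s_{LU}f(x^* )-\mathcal{E}\|x-x^*\|$. For $\epsilon\in\mathbb{R}^2_+$ and $x^*\in X$, regarding $\mathrm{Min}_{\mathbb{R}^2_+}\{F(x):x\in X\}$: - $x^*$ is weakly $\epsilon$-efficient if there is no $x\in X$ with $F(x)\in F(x^* )-\epsilon-\mathrm{int}\,\mathbb{R}^2_+$;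 - $x^*$ is $\epsilon$-quasi-efficient if there is no $x\in X$ with $F(x)\in F(x^* )-\epsilon\|x-x^*\|-(\mathbb{R}^2_+\setminus\{0\})$; - $x^*$ is weakly $\epsilon$-quasi-efficient if there is no $x\in X$ with $F(x)\in F(x^* )-\epsilon\|x-x^*\|-\mathrm{int}\,\mathbb{R}^2_+$. *)

theory Defs
  imports "HOL-Analysis.Analysis" "HOL-Library.Interval"
begin

text \<open>The set of closed bounded real intervals is the type \<^typ>\<open>real interval\<close>, with endpoints
  \<^const>\<open>lower\<close> and \<^const>\<open>upper\<close>; its subtraction is the interval subtraction used here, see
  \<open>lower_minus\<close> and \<open>upper_minus\<close>. The library order on intervals is inclusion,
  so the \<open>LU\<close> orders are introduced separately.\<close>

definition LU_le :: "real interval \<Rightarrow> real interval \<Rightarrow> bool" (infix "\<preceq>\<^sub>L\<^sub>U" 50) where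
  "A \<preceq>\<^sub>L\<^sub>U B \<longleftrightarrow> lower A \<le> lower B \<and> upper A \<le> upper B"

definition LU_less :: "real interval \<Rightarrow> real interval \<Rightarrow> bool" (infix "\<prec>\<^sub>L\<^sub>U" 50) where
  "A \<prec>\<^sub>L\<^sub>U B \<longleftrightarrow> A \<preceq>\<^sub>L\<^sub>U B \<and> A \<noteq> B"

definition LU_sless :: "real interval \<Rightarrow> real interval \<Rightarrow> bool" (infix "\<prec>\<^sup>s\<^sub>L\<^sub>U" 50) where
  "A \<prec>\<^sup>s\<^sub>L\<^sub>U B \<longleftrightarrow> lower A < lower B \<and> upper A < upper B"

text \<open>Meaningful only for \<open>k \<ge> 0\<close>: otherwise the argument of \<^const>\<open>Interval\<close> need not be an
  ordered pair. Below, \<open>k\<close> is always a norm.\<close>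

definition interval_scale :: "real \<Rightarrow> real interval \<Rightarrow> real interval" where
  "interval_scale k A = Interval (k * lower A, k * upper A)"

lemma
  assumes "0 \<le> k"
  shows lower_interval_scale: "lower (interval_scale k A) = k * lower A"
    and upper_interval_scale: "upper (interval_scale k A) = k * upper A"
  using assms
  by (simp_all add: interval_scale_def lower.rep_eq upper.rep_eq Interval_inverse mult_left_mono
      lower_le_upper[unfolded lower.rep_eq upper.rep_eq])

definition weakly_LU_solution ::
    "(real ^ 'n \<Rightarrow> real interval) \<Rightarrow> (real ^ 'n) set \<Rightarrow> real interval \<Rightarrow> real ^ 'n \<Rightarrow> bool" where
  "weakly_LU_solution f X E xs \<longleftrightarrow>
    xs \<in> X \<and> \<not> (\<exists>x\<in>X. f x \<prec>\<^sup>s\<^sub>L\<^sub>U f xs - E)"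

definition quasi_LU_solution ::
    "(real ^ 'n \<Rightarrow> real interval) \<Rightarrow> (real ^ 'n) set \<Rightarrow> real interval \<Rightarrow> real ^ 'n \<Rightarrow> bool" where
  "quasi_LU_solution f X E xs \<longleftrightarrow>
    xs \<in> X \<and> \<not> (\<exists>x\<in>X. f x \<prec>\<^sub>L\<^sub>U f xs - interval_scale (norm (x - xs)) E)"

definition weakly_quasi_LU_solution ::
    "(real ^ 'n \<Rightarrow> real interval) \<Rightarrow> (real ^ 'n) set \<Rightarrow> real interval \<Rightarrow> real ^ 'n \<Rightarrow> bool" where
  "weakly_quasi_LU_solution f X E xs \<longleftrightarrow>
    xs \<in> X \<and> \<not> (\<exists>x\<in>X. f x \<prec>\<^sup>s\<^sub>L\<^sub>U f xs - interval_scale (norm (x - xs)) E)"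

definition R2_plus :: "(real \<times> real) set" where
  "R2_plus = {(a, b). 0 \<le> a \<and> 0 \<le> b}"

text \<open>For a point \<open>p\<close> and a set \<open>D\<close>, the set \<open>p - D\<close> is the image of \<open>D\<close> under \<open>\<lambda>d. p - d\<close>.\<close>

definition weakly_efficient ::
    "(real ^ 'n \<Rightarrow> real \<times> real) \<Rightarrow> (real ^ 'n) set \<Rightarrow> real \<times> real \<Rightarrow> real ^ 'n \<Rightarrow> bool" where
  "weakly_efficient F X e xs \<longleftrightarrow>
    xs \<in> X \<and> \<not> (\<exists>x\<in>X. F x \<in> (\<lambda>d. F xs - e - d) ` interior R2_plus)"

definition quasi_efficient ::
    "(real ^ 'n \<Rightarrow> real \<times> real) \<Rightarrow> (real ^ 'n) set \<Rightarrow> real \<times> real \<Rightarrow> real ^ 'n \<Rightarrow> bool" where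
  "quasi_efficient F X e xs \<longleftrightarrow>
    xs \<in> X \<and> \<not> (\<exists>x\<in>X. F x \<in> (\<lambda>d. F xs - norm (x - xs) *\<^sub>R e - d) ` (R2_plus - {0}))"

definition weakly_quasi_efficient ::
    "(real ^ 'n \<Rightarrow> real \<times> real) \<Rightarrow> (real ^ 'n) set \<Rightarrow> real \<times> real \<Rightarrow> real ^ 'n \<Rightarrow> bool" where
  "weakly_quasi_efficient F X e xs \<longleftrightarrow>
    xs \<in> X \<and> \<not> (\<exists>x\<in>X. F x \<in> (\<lambda>d. F xs - norm (x - xs) *\<^sub>R e - d) ` interior R2_plus)"

end

theory Submission
  imports Defs
begin

text \<open>The quadrant is a product of closed half-lines, and interior commutes with products;
  membership thus becomes two strict inequalities, as in \<open>LU_sless\<close>.\<close>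

lemma interior_R2_plus: "interior R2_plus = {0<..} \<times> {0<..}"
proof -
  have *: "R2_plus = {0..} \<times> {0..}"
    by (auto simp: R2_plus_def)
  show ?thesis
    unfolding * interior_Times by simp
qed

text \<open>The map \<open>\<lambda>d. p - d\<close> is its own inverse.\<close>

lemma mem_image_diff_iff:
  fixes p q :: "'a::ab_group_add"
  shows "q \<in> (\<lambda>d. p - d) ` D \<longleftrightarrow> p - q \<in> D"
  by (force simp: image_iff algebra_simps)

text \<open>Interval subtraction subtracts the upper endpoint of \<open>C\<close> from the lower endpoint of \<open>B\<close>;
  this is why the vector subtracted on the right has its components swapped.\<close>

lemma LU_sless_minus_iff:
  "A \<prec>\<^sup>s\<^sub>L\<^sub>U B - C \<longleftrightarrow>
    (lower A, upper A) \<in>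
      (\<lambda>d. (lower B, upper B) - (upper C, lower C) - d) ` interior R2_plus"
  by (auto simp: mem_image_diff_iff interior_R2_plus LU_sless_def)

text \<open>Intervals agree iff both endpoints do, so \<open>A \<noteq> B - C\<close> corresponds to
  removing 0 from the cone.\<close>

lemma LU_less_minus_iff:
  "A \<prec>\<^sub>L\<^sub>U B - C \<longleftrightarrow>
    (lower A, upper A) \<in>
      (\<lambda>d. (lower B, upper B) - (upper C, lower C) - d) ` (R2_plus - {0})"
  by (auto simp: mem_image_diff_iff R2_plus_def LU_less_def LU_le_def interval_eq_iff
      zero_prod_def)

theorem lemma2p2:
  fixes f :: "real ^ 'n \<Rightarrow> real interval"
    and g :: "nat \<Rightarrow> real ^ 'n \<Rightarrow> real"
    and m :: nat
    and X :: "(real ^ 'n) set"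
    and E :: "real interval"
    and e :: "real \<times> real"
    and F :: "real ^ 'n \<Rightarrow> real \<times> real"
    and xs :: "real ^ 'n"
  assumes X: "X = {x. \<forall>j\<in>{1..m}. g j x \<le> 0}"
    and E: "0 \<le> lower E"
    and e: "e = (upper E, lower E)"
    and F: "F = (\<lambda>x. (lower (f x), upper (f x)))"
  shows "(weakly_LU_solution f X E xs \<longleftrightarrow> weakly_efficient F X e xs) \<and>
    (quasi_LU_solution f X E xs \<longleftrightarrow> quasi_efficient F X e xs) \<and>
    (weakly_quasi_LU_solution f X E xs \<longleftrightarrow> weakly_quasi_efficient F X e xs)"
  unfolding weakly_LU_solution_def weakly_efficient_def quasi_LU_solution_def
    quasi_efficient_def weakly_quasi_LU_solution_def weakly_quasi_efficient_def
    LU_sless_minus_iff LU_less_minus_iff F e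
  \<comment> \<open>Since norms are nonnegative, scaling \<open>E\<close> acts on each endpoint, so
    the swapped endpoints of the scaled interval form
    \<open>norm (x - xs) *\<^sub>R e\<close>.\<close>
  by (simp add: lower_interval_scale upper_interval_scale)

end
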